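(* Let $\mathfrak{k}$ be a simple compact Lie superalgebra with $\mathfrak{k}_1\neq\{0\}$ and let $s$ be a positive integer. Then $\Lambda_s^+(\mathbb{R})\otimes\mathfrak{k}$ lies in the kernel of each unitary representation of $\mathfrak{g}=\Lambda_s(\mathbb{R})\otimes\mathfrak{k}$; in particular, unitary representations of $\mathfrak{g}$ are in one-to-one correspondence with unitary representations of $\mathfrak{k}$.
   Context: All Lie superalgebras are finite dimensional and real. A Lie superalgebra $\mathfrak{k}=\mathfrak{k}_0\oplus\mathfrak{k}_1$ is compact if the subgroup of $\operatorname{Aut}(\mathfrak{k})$ generated by $e^{\operatorname{ad}(\mathfrak{k}_0)}$ has compact closure. $\Lambda_s(\mathbb{R})$ is the real Grassmann superalgebra, i.e., the unital supercommutative associative superalgebra generated by odd elements $\epsilon_1,\ldots,\epsilon_s$ with relations $\epsilon_i\epsilon_j+\epsilon_j\epsilon_i=0$. It is $\mathbb{Z}$-graded, with $\Lambda_s^m(\mathbb{R})$ the span of the products $\epsilon_{i_1}\cdots\epsilon_{i_m}$, $i_1<\cdots<i_m$, and $\Lambda_s^+(\mathbb{R})=\bigoplus_{m\geq1}\Lambda_s^m(\mathbb{R})$. The bracket on $\Lambda_s(\mathbb{R})\otimes\mathfrak{k}$ is $[a\otimes x,b\otimes y]=(-1)^{|x||b|}ab\otimes[x,y]$ for homogeneous elements. A pre-Hilbert superspace is a complex $\mathbb{Z}_2$-graded space $\mathscr{H}=\mathscr{H}_0\oplus\mathscr{H}_1$ with an inner product $\langle\cdot,\cdot\rangle$ (linear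 in the first argument) such that $\langle\mathscr{H}_0,\mathscr{H}_1\rangle=\{0\}$. A unitary representation of a real Lie superalgebra $\mathfrak{g}$ in a pre-Hilbert superspace $\mathscr{H}$ is a homomorphism of real Lie superalgebras $\chi\colon\mathfrak{g}\to\operatorname{End}(\mathscr{H})$ with $\langle\chi(X)u,v\rangle=\langle u,-i^{|X|}\chi(X)v\rangle$ for all homogeneous $X\in\mathfrak{g}$ and $u,v\in\mathscr{H}$. *)

theory Defs
  imports "HOL-Analysis.Analysis" "HOL-Algebra.Generated_Groups" "HOL-Library.Z2"
begin

section \<open>Real Lie superalgebras\<close>

text \<open>A \<open>\<int>\<^sub>2\<close>-grading is a family of subspaces indexed by the two-element field \<^typ>\<open>bit\<close>, so
  that addition of degrees is taken modulo 2.\<close>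

definition super_grading :: "(bit \<Rightarrow> 'v::real_vector set) \<Rightarrow> bool" where
  "super_grading V \<longleftrightarrow>
     (\<forall>p. subspace (V p)) \<and> V 0 \<inter> V 1 = {0} \<and> (\<forall>v. \<exists>a\<in>V 0. \<exists>b\<in>V 1. v = a + b)"

definition component :: "(bit \<Rightarrow> 'v::real_vector set) \<Rightarrow> bit \<Rightarrow> 'v \<Rightarrow> 'v" where
  "component V p v = (THE a. a \<in> V p \<and> v - a \<in> V (p + 1))"

text \<open>The Koszul sign \<open>(-1)\<^bsup>pq\<^esup>\<close>.\<close>

definition ksign :: "bit \<Rightarrow> bit \<Rightarrow> real" where
  "ksign p q = (if p = 1 \<and> q = 1 then - 1 else 1)"

locale lie_superalgebra =
  fixes L :: "bit \<Rightarrow> 'k::real_vector set" and br :: "'k \<Rightarrow> 'k \<Rightarrow> 'k"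
  assumes grading: "super_grading L"
    and bilinear: "bilinear br"
    and br_closed: "x \<in> L p \<Longrightarrow> y \<in> L q \<Longrightarrow> br x y \<in> L (p + q)"
    and br_skew: "x \<in> L p \<Longrightarrow> y \<in> L q \<Longrightarrow> br x y = - (ksign p q *\<^sub>R br y x)"
    and br_jacobi: "x \<in> L p \<Longrightarrow> y \<in> L q \<Longrightarrow> z \<in> L r \<Longrightarrow>
      br x (br y z) = br (br x y) z + ksign p q *\<^sub>R br y (br x z)"

definition graded_ideal :: "(bit \<Rightarrow> 'k::real_vector set) \<Rightarrow> ('k \<Rightarrow> 'k \<Rightarrow> 'k) \<Rightarrow> 'k set \<Rightarrow> bool" where
  "graded_ideal L br I \<longleftrightarrow> subspace I \<and>
     (\<forall>x\<in>I. \<exists>a\<in>I \<inter> L 0. \<exists>b\<in>I \<inter> L 1. x = a + b) \<and>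
     (\<forall>x. \<forall>y\<in>I. br x y \<in> I \<and> br y x \<in> I)"

definition simple_lie_superalgebra :: "(bit \<Rightarrow> 'k::real_vector set) \<Rightarrow> ('k \<Rightarrow> 'k \<Rightarrow> 'k) \<Rightarrow> bool" where
  "simple_lie_superalgebra L br \<longleftrightarrow> lie_superalgebra L br \<and> (\<exists>x y. br x y \<noteq> 0) \<and>
     (\<forall>I. graded_ideal L br I \<longrightarrow> I = {0} \<or> I = UNIV)"


section \<open>Compactness\<close>

text \<open>On a Euclidean space all linear maps are bounded, so \<open>End(\<kk>)\<close> is the type
  \<^typ>\<open>'k::euclidean_space \<Rightarrow>\<^sub>L 'k\<close>.  The inner product of the type class is used only through the
  topology, which does not depend on it.\<close>

definition lie_aut :: "(bit \<Rightarrow> 'k::euclidean_space set) \<Rightarrow> ('k \<Rightarrow> 'k \<Rightarrow> 'k) \<Rightarrow> ('k \<Rightarrow>\<^sub>L 'k) set" where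
  "lie_aut L br = {A. bij (blinfun_apply A) \<and> (\<forall>p. blinfun_apply A ` L p \<subseteq> L p) \<and>
     (\<forall>x y. blinfun_apply A (br x y) = br (blinfun_apply A x) (blinfun_apply A y))}"

definition aut_group ::
    "(bit \<Rightarrow> 'k::euclidean_space set) \<Rightarrow> ('k \<Rightarrow> 'k \<Rightarrow> 'k) \<Rightarrow> ('k \<Rightarrow>\<^sub>L 'k) monoid" where
  "aut_group L br = \<lparr>carrier = lie_aut L br, mult = blinfun_compose, one = id_blinfun\<rparr>"

definition blinfun_exp :: "('k::euclidean_space \<Rightarrow>\<^sub>L 'k) \<Rightarrow> 'k \<Rightarrow>\<^sub>L 'k" where
  "blinfun_exp T = (\<Sum>n. (((\<lambda>S. T o\<^sub>L S) ^^ n) id_blinfun) /\<^sub>R fact n)"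

definition compact_lie_superalgebra ::
    "(bit \<Rightarrow> 'k::euclidean_space set) \<Rightarrow> ('k \<Rightarrow> 'k \<Rightarrow> 'k) \<Rightarrow> bool" where
  "compact_lie_superalgebra L br \<longleftrightarrow> lie_superalgebra L br \<and>
     compactin (top_of_set (lie_aut L br))
       (Abstract_Topology.closure_of (top_of_set (lie_aut L br))
          (generate (aut_group L br) ((\<lambda>x. blinfun_exp (Blinfun (br x))) ` L 0)))"


section \<open>The Grassmann superalgebra and the tensor product with a Lie superalgebra\<close>

text \<open>The generators \<open>\<epsilon>\<^sub>i\<close> are indexed by a finite linearly ordered type \<open>'s\<close>, so that
  \<open>s = CARD('s)\<close> is an arbitrary positive integer.  An element of \<open>\<Lambda>\<^sub>s(\<real>)\<close> is the family of its
  coefficients with respect to the basis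
  \<open>\<epsilon>\<^sub>I = \<epsilon>\<^bsub>i\<^sub>1\<^esub>\<cdots>\<epsilon>\<^bsub>i\<^sub>m\<^esub>\<close>, \<open>I = {i\<^sub>1 < \<cdots> < i\<^sub>m}\<close>, and an element of \<open>\<Lambda>\<^sub>s(\<real>) \<otimes> \<kk>\<close> is
  the family of its coefficients in \<open>\<kk>\<close> with respect to the same basis.  For disjoint \<open>I\<close>, \<open>J\<close> one has
  \<open>\<epsilon>\<^sub>I \<epsilon>\<^sub>J = gsign I J \<epsilon>\<^bsub>I \<union> J\<^esub>\<close>; otherwise the product vanishes.\<close>

definition gsign :: "'s::{finite,linorder} set \<Rightarrow> 's set \<Rightarrow> real" where
  "gsign I J = (- 1) ^ card {(i, j). i \<in> I \<and> j \<in> J \<and> j < i}"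

definition gmult ::
    "real ^ 's::{finite,linorder} set \<Rightarrow> real ^ 's set \<Rightarrow> real ^ 's set" (infixl "\<bullet>\<^sub>\<Lambda>" 70) where
  "a \<bullet>\<^sub>\<Lambda> b = (\<chi> M. \<Sum>I\<in>Pow M. gsign I (M - I) * a $ I * b $ (M - I))"

definition gone :: "real ^ 's::{finite,linorder} set" ("\<one>\<^sub>\<Lambda>") where
  "\<one>\<^sub>\<Lambda> = axis {} 1"

definition eps :: "'s::{finite,linorder} \<Rightarrow> real ^ 's set" where
  "eps i = axis {i} 1"

definition gprod :: "'s::{finite,linorder} list \<Rightarrow> real ^ 's set" where
  "gprod is = foldr (\<lambda>i a. eps i \<bullet>\<^sub>\<Lambda> a) is \<one>\<^sub>\<Lambda>"

definition grassmann_deg :: "nat \<Rightarrow> (real ^ 's::{finite,linorder} set) set" where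
  "grassmann_deg m = span {gprod is |is. sorted_wrt (<) is \<and> length is = m}"

definition grassmann_plus :: "(real ^ 's::{finite,linorder} set) set" where
  "grassmann_plus = span (\<Union>m\<in>{1..}. grassmann_deg m)"

definition grassmann_grading :: "bit \<Rightarrow> (real ^ 's::{finite,linorder} set) set" where
  "grassmann_grading p = {a. \<forall>I. a $ I \<noteq> 0 \<longrightarrow> of_nat (card I) = p}"

definition tensor :: "real ^ 's::{finite,linorder} set \<Rightarrow> 'k \<Rightarrow> 'k::euclidean_space ^ 's set"
    (infixl "\<otimes>\<^sub>\<Lambda>" 70) where
  "a \<otimes>\<^sub>\<Lambda> x = (\<chi> I. a $ I *\<^sub>R x)"

definition current_grading ::
    "(bit \<Rightarrow> 'k::euclidean_space set) \<Rightarrow> bit \<Rightarrow> ('k ^ 's::{finite,linorder} set) set" where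
  "current_grading L p = {X. \<forall>I. X $ I \<in> L (of_nat (card I) + p)}"

text \<open>Bilinear extension of
  \<open>[\<epsilon>\<^sub>I \<otimes> x, \<epsilon>\<^sub>J \<otimes> y] = (-1)\<^bsup>|x||\<epsilon>\<^sub>J|\<^esup> \<epsilon>\<^sub>I \<epsilon>\<^sub>J \<otimes> [x, y]\<close> for homogeneous \<open>x\<close>; the inner sum splits
  the left-hand coefficient into its homogeneous components.  The lemma \<open>current_bracket_tensor\<close>
  below gives the rule for homogeneous pure tensors.\<close>

definition current_bracket ::
    "(bit \<Rightarrow> 'k::euclidean_space set) \<Rightarrow> ('k \<Rightarrow> 'k \<Rightarrow> 'k) \<Rightarrow>
     'k ^ 's::{finite,linorder} set \<Rightarrow> 'k ^ 's set \<Rightarrow> 'k ^ 's set" where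
  "current_bracket L br X Y = (\<chi> M. \<Sum>I\<in>Pow M. \<Sum>p\<in>{0, 1}.
     (ksign p (of_nat (card (M - I))) * gsign I (M - I)) *\<^sub>R
       br (component L p (X $ I)) (Y $ (M - I)))"

definition current_plus :: "('k::euclidean_space ^ 's::{finite,linorder} set) set" where
  "current_plus = span {a \<otimes>\<^sub>\<Lambda> x |a x. a \<in> grassmann_plus}"


section \<open>Unitary representations\<close>

text \<open>The inner product is linear in the first argument.\<close>

locale pre_hilbert_superspace = vector_space cscale
  for cscale :: "complex \<Rightarrow> 'h::ab_group_add \<Rightarrow> 'h" +
  fixes H :: "bit \<Rightarrow> 'h set" and ip :: "'h \<Rightarrow> 'h \<Rightarrow> complex"
  assumes subspace_H: "subspace (H p)"
    and H_disjoint: "H 0 \<inter> H 1 = {0}"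
    and H_sum: "\<exists>a\<in>H 0. \<exists>b\<in>H 1. v = a + b"
    and ip_add: "ip (u + v) w = ip u w + ip v w"
    and ip_scale: "ip (cscale c u) v = c * ip u v"
    and ip_cnj: "ip v u = cnj (ip u v)"
    and ip_nonneg: "0 \<le> Re (ip v v)"
    and ip_definite: "ip v v = 0 \<Longrightarrow> v = 0"
    and ip_orthogonal: "u \<in> H 0 \<Longrightarrow> v \<in> H 1 \<Longrightarrow> ip u v = 0"

definition end_grading ::
    "(complex \<Rightarrow> 'h::ab_group_add \<Rightarrow> 'h) \<Rightarrow> (bit \<Rightarrow> 'h set) \<Rightarrow> bit \<Rightarrow> ('h \<Rightarrow> 'h) set" where
  "end_grading cscale H p =
     {T. Vector_Spaces.linear cscale cscale T \<and> (\<forall>q. \<forall>v\<in>H q. T v \<in> H (p + q))}"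

text \<open>A homomorphism of real Lie superalgebras \<open>\<rho> : \<gg> \<rightarrow> End(\<H>)\<close>, for the supercommutator
  \<open>[S, T] = S T - (-1)\<^bsup>|S||T|\<^esup> T S\<close> on \<open>End(\<H>)\<close>, with
  \<open>\<langle>\<rho>(X)u, v\<rangle> = \<langle>u, -i\<^bsup>|X|\<^esup> \<rho>(X)v\<rangle>\<close>.\<close>

definition unitary_rep ::
    "(bit \<Rightarrow> 'g::real_vector set) \<Rightarrow> ('g \<Rightarrow> 'g \<Rightarrow> 'g) \<Rightarrow>
     (complex \<Rightarrow> 'h::ab_group_add \<Rightarrow> 'h) \<Rightarrow> (bit \<Rightarrow> 'h set) \<Rightarrow> ('h \<Rightarrow> 'h \<Rightarrow> complex) \<Rightarrow>
     ('g \<Rightarrow> 'h \<Rightarrow> 'h) \<Rightarrow> bool" where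
  "unitary_rep L br cscale H ip \<rho> \<longleftrightarrow>
     (\<forall>X. Vector_Spaces.linear cscale cscale (\<rho> X)) \<and>
     (\<forall>X Y v. \<rho> (X + Y) v = \<rho> X v + \<rho> Y v) \<and>
     (\<forall>r X v. \<rho> (r *\<^sub>R X) v = cscale (of_real r) (\<rho> X v)) \<and>
     (\<forall>p. \<forall>X\<in>L p. \<rho> X \<in> end_grading cscale H p) \<and>
     (\<forall>p q. \<forall>X\<in>L p. \<forall>Y\<in>L q. \<forall>v.
        \<rho> (br X Y) v = \<rho> X (\<rho> Y v) - cscale (of_real (ksign p q)) (\<rho> Y (\<rho> X v))) \<and>
     (\<forall>p. \<forall>X\<in>L p. \<forall>u v.
        ip (\<rho> X u) v = ip u (cscale (- (if p = 1 then \<i> else 1)) (\<rho> X v)))"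

definition rep_kernel :: "('g \<Rightarrow> 'h \<Rightarrow> 'h::zero) \<Rightarrow> 'g set" where
  "rep_kernel \<rho> = {X. \<forall>v. \<rho> X v = 0}"


section \<open>Basic properties of these structures\<close>

text \<open>\<open>\<Lambda>\<^sub>s(\<real>)\<close> is a unital supercommutative associative superalgebra with the required
  relations, \<open>\<Lambda>\<^sub>s(\<real>) \<otimes> \<kk>\<close> is a Lie superalgebra with the bracket of the tensor product, and
  \<open>aut_group\<close> is a group.\<close>

lemma of_nat_bit: "(of_nat n :: bit) = (if even n then 0 else 1)"
  by (induction n) auto

lemma gsign_Un_left:
  fixes I J K :: "'s::{finite,linorder} set"
  assumes "I \<inter> J = {}" shows "gsign (I \<union> J) K = gsign I K * gsign J K"
proof -
  have e: "{(i, j). i \<in> I \<union> J \<and> j \<in> K \<and> j < i} =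
      {(i, j). i \<in> I \<and> j \<in> K \<and> j < i} \<union> {(i, j). i \<in> J \<and> j \<in> K \<and> j < i}" by auto
  have "{(i, j). i \<in> I \<and> j \<in> K \<and> j < i} \<inter> {(i, j). i \<in> J \<and> j \<in> K \<and> j < i} = {}"
    using assms by auto
  then show ?thesis unfolding gsign_def e by (simp add: card_Un_disjoint power_add)
qed

lemma gsign_Un_right:
  fixes I J K :: "'s::{finite,linorder} set"
  assumes "J \<inter> K = {}" shows "gsign I (J \<union> K) = gsign I J * gsign I K"
proof -
  have e: "{(i, j). i \<in> I \<and> j \<in> J \<union> K \<and> j < i} =
      {(i, j). i \<in> I \<and> j \<in> J \<and> j < i} \<union> {(i, j). i \<in> I \<and> j \<in> K \<and> j < i}" by auto
  have "{(i, j). i \<in> I \<and> j \<in> J \<and> j < i} \<inter> {(i, j). i \<in> I \<and> j \<in> K \<and> j < i} = {}"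
    using assms by auto
  then show ?thesis unfolding gsign_def e by (simp add: card_Un_disjoint power_add)
qed

lemma gsign_swap:
  fixes I J :: "'s::{finite,linorder} set"
  assumes "I \<inter> J = {}"
  shows "gsign J I = ksign (of_nat (card I)) (of_nat (card J)) * gsign I J"
proof -
  have s: "{(j, i). j \<in> J \<and> i \<in> I \<and> i < j} = prod.swap ` {(i, j). i \<in> I \<and> j \<in> J \<and> i < j}"
    by force
  have c: "card {(j, i). j \<in> J \<and> i \<in> I \<and> i < j} = card {(i, j). i \<in> I \<and> j \<in> J \<and> i < j}"
    unfolding s by (rule card_image) (auto simp: inj_on_def)
  have u: "{(i, j). i \<in> I \<and> j \<in> J \<and> i < j} \<union> {(i, j). i \<in> I \<and> j \<in> J \<and> j < i} = I \<times> J"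
    using assms by fastforce
  have d: "{(i, j). i \<in> I \<and> j \<in> J \<and> i < j} \<inter> {(i, j). i \<in> I \<and> j \<in> J \<and> j < i} = {}"
    by auto
  have "gsign J I * gsign I J = (- 1) ^ card (I \<times> J)"
    unfolding gsign_def c u[symmetric]
    by (subst card_Un_disjoint) (use d in \<open>auto simp: power_add\<close>)
  also have "\<dots> = ksign (of_nat (card I)) (of_nat (card J))"
    by (cases "even (card I)"; cases "even (card J)") (auto simp: card_cartesian_product ksign_def of_nat_bit)
  finally have "gsign J I * (gsign I J * gsign I J) = ksign (of_nat (card I)) (of_nat (card J)) * gsign I J"
    by simp
  moreover have "gsign I J * gsign I J = 1" by (simp add: gsign_def flip: power_add)
  ultimately show ?thesis by simp
qed

lemma gsign_empty [simp]: "gsign {} J = 1" "gsign I {} = 1"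
  by (simp_all add: gsign_def)

lemma gmult_axis:
  fixes I J :: "'s::{finite,linorder} set"
  shows "axis I a \<bullet>\<^sub>\<Lambda> axis J b = (if I \<inter> J = {} then axis (I \<union> J) (gsign I J * a * b) else 0)"
proof -
  have "(axis I a \<bullet>\<^sub>\<Lambda> axis J b) $ M = (if I \<subseteq> M \<and> M - I = J then gsign I J * a * b else 0)" for M
  proof -
    have "(axis I a \<bullet>\<^sub>\<Lambda> axis J b) $ M =
        (\<Sum>I'\<in>Pow M. if I' = I then (if M - I = J then gsign I J * a * b else 0) else 0)"
      unfolding gmult_def vec_lambda_beta by (intro sum.cong) (auto simp: axis_def)
    then show ?thesis by auto
  qed
  then show ?thesis
    by (simp add: vec_eq_iff axis_def) blast
qed

lemma gmult_one [simp]: "\<one>\<^sub>\<Lambda> \<bullet>\<^sub>\<Lambda> a = a" "a \<bullet>\<^sub>\<Lambda> \<one>\<^sub>\<Lambda> = a"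
proof -
  have "(\<one>\<^sub>\<Lambda> \<bullet>\<^sub>\<Lambda> a) $ M = (\<Sum>I\<in>Pow M. if I = {} then a $ M else 0)" for M
    unfolding gmult_def gone_def vec_lambda_beta by (intro sum.cong) (auto simp: axis_def)
  then show "\<one>\<^sub>\<Lambda> \<bullet>\<^sub>\<Lambda> a = a" by (simp add: vec_eq_iff)
  have "(a \<bullet>\<^sub>\<Lambda> \<one>\<^sub>\<Lambda>) $ M = (\<Sum>I\<in>Pow M. if I = M then a $ M else 0)" for M
    unfolding gmult_def gone_def vec_lambda_beta by (intro sum.cong) (auto simp: axis_def)
  then show "a \<bullet>\<^sub>\<Lambda> \<one>\<^sub>\<Lambda> = a" by (simp add: vec_eq_iff)
qed

lemma eps_anticommute: "eps i \<bullet>\<^sub>\<Lambda> eps j + eps j \<bullet>\<^sub>\<Lambda> eps i = 0"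
proof (cases "i = j")
  case False
  have "gsign {j} {i} = - gsign {i} {j}" using gsign_swap[of "{i}" "{j}"] False by (simp add: ksign_def)
  moreover have "axis M (- c) = - axis M c" for M :: "'a set" and c :: real
    by (simp add: axis_def vec_eq_iff)
  ultimately show ?thesis using False by (simp add: eps_def gmult_axis insert_commute)
qed (simp add: eps_def gmult_axis)

lemma sum_Pow_assoc:
  fixes f :: "'s::finite set \<Rightarrow> 's set \<Rightarrow> 's set \<Rightarrow> 'b::comm_monoid_add"
  shows "(\<Sum>I\<in>Pow M. \<Sum>J\<in>Pow (M - I). f I J (M - I - J)) =
         (\<Sum>K\<in>Pow M. \<Sum>I\<in>Pow K. f I (K - I) (M - K))"
proof -
  have "(\<Sum>I\<in>Pow M. \<Sum>J\<in>Pow (M - I). f I J (M - I - J)) =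
        (\<Sum>(I, J)\<in>Sigma (Pow M) (\<lambda>I. Pow (M - I)). f I J (M - I - J))"
    by (rule sum.Sigma) auto
  also have "\<dots> = (\<Sum>(K, I)\<in>Sigma (Pow M) Pow. f I (K - I) (M - K))"
    by (rule sum.reindex_bij_witness[where i = "\<lambda>(K, I). (I, K - I)" and j = "\<lambda>(I, J). (I \<union> J, I)"])
       (auto intro!: arg_cong2[where f = "f _"])
  also have "\<dots> = (\<Sum>K\<in>Pow M. \<Sum>I\<in>Pow K. f I (K - I) (M - K))"
    by (rule sum.Sigma[symmetric]) auto
  finally show ?thesis .
qed

lemma sum_Pow_swap:
  fixes f :: "'s::finite set \<Rightarrow> 's set \<Rightarrow> 'b::comm_monoid_add"
  shows "(\<Sum>I\<in>Pow M. f I (M - I)) = (\<Sum>J\<in>Pow M. f (M - J) J)"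
  by (rule sum.reindex_bij_witness[where i = "\<lambda>J. M - J" and j = "\<lambda>J. M - J"])
     (auto simp: double_diff)

lemma gmult_assoc: "(a \<bullet>\<^sub>\<Lambda> b) \<bullet>\<^sub>\<Lambda> c = a \<bullet>\<^sub>\<Lambda> (b \<bullet>\<^sub>\<Lambda> c)"
proof -
  have "((a \<bullet>\<^sub>\<Lambda> b) \<bullet>\<^sub>\<Lambda> c) $ M = (a \<bullet>\<^sub>\<Lambda> (b \<bullet>\<^sub>\<Lambda> c)) $ M" for M
  proof -
    let ?f = "\<lambda>I J K. gsign I J * gsign I K * gsign J K * a $ I * b $ J * c $ K"
    have "(a \<bullet>\<^sub>\<Lambda> (b \<bullet>\<^sub>\<Lambda> c)) $ M = (\<Sum>I\<in>Pow M. \<Sum>J\<in>Pow (M - I). ?f I J (M - I - J))"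
    proof -
      have "gsign I (M - I) = gsign I J * gsign I (M - I - J)" if "J \<subseteq> M - I" for I J
        using gsign_Un_right[of J "M - I - J" I] that by (simp add: Un_absorb1)
      then show ?thesis
        unfolding gmult_def by (auto simp: sum_distrib_left intro!: sum.cong)
    qed
    moreover have "((a \<bullet>\<^sub>\<Lambda> b) \<bullet>\<^sub>\<Lambda> c) $ M = (\<Sum>K\<in>Pow M. \<Sum>I\<in>Pow K. ?f I (K - I) (M - K))"
    proof -
      have "gsign K (M - K) = gsign I (M - K) * gsign (K - I) (M - K)" if "I \<subseteq> K" for I K
        using gsign_Un_left[of I "K - I" "M - K"] that by (simp add: Un_absorb1)
      then show ?thesis
        unfolding gmult_def by (auto simp: sum_distrib_left sum_distrib_right intro!: sum.cong)
    qed
    ultimately show ?thesis using sum_Pow_assoc[of ?f M] by simp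
  qed
  then show ?thesis by (simp add: vec_eq_iff)
qed

lemma gmult_supercommute:
  assumes "a \<in> grassmann_grading p" "b \<in> grassmann_grading q"
  shows "a \<bullet>\<^sub>\<Lambda> b = ksign p q *\<^sub>R (b \<bullet>\<^sub>\<Lambda> a)"
proof -
  have "(a \<bullet>\<^sub>\<Lambda> b) $ M = (ksign p q *\<^sub>R (b \<bullet>\<^sub>\<Lambda> a)) $ M" for M
  proof -
    have "(a \<bullet>\<^sub>\<Lambda> b) $ M = (\<Sum>J\<in>Pow M. gsign (M - J) J * a $ (M - J) * b $ J)"
      unfolding gmult_def using sum_Pow_swap[of "\<lambda>I J. gsign I J * a $ I * b $ J" M] by simp
    also have "\<dots> = (\<Sum>J\<in>Pow M. ksign p q * (gsign J (M - J) * b $ J * a $ (M - J)))"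
    proof (rule sum.cong)
      fix J assume "J \<in> Pow M"
      have "J \<inter> (M - J) = {}" by auto
      from gsign_swap[OF this] show "gsign (M - J) J * a $ (M - J) * b $ J =
        ksign p q * (gsign J (M - J) * b $ J * a $ (M - J))"
        using assms by (cases "a $ (M - J) = 0"; cases "b $ J = 0")
          (auto simp: grassmann_grading_def ksign_def)
    qed simp
    finally show ?thesis by (simp add: gmult_def sum_distrib_left)
  qed
  then show ?thesis by (simp add: vec_eq_iff)
qed

lemma gprod_sorted: "sorted_wrt (<) is \<Longrightarrow> gprod is = axis (set is) 1"
proof (induction "is")
  case (Cons i "is")
  then have "{(i', j). i' \<in> {i} \<and> j \<in> set is \<and> j < i'} = {}" "i \<notin> set is" by auto
  then have "gsign {i} (set is) = 1" by (simp only: gsign_def) simp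
  moreover have "gprod (i # is) = eps i \<bullet>\<^sub>\<Lambda> gprod is" by (simp add: gprod_def)
  ultimately show ?case using Cons \<open>i \<notin> set is\<close> by (simp add: eps_def gmult_axis)
qed (simp add: gprod_def gone_def)

lemma component_eq:
  assumes "super_grading V" "a \<in> V p" "b \<in> V (p + 1)" shows "component V p (a + b) = a"
proof -
  have sub: "subspace (V q)" for q using assms by (simp add: super_grading_def)
  have "c = a" if "c \<in> V p" "a + b - c \<in> V (p + 1)" for c
  proof -
    have "c - a \<in> V p" using that assms sub by (simp add: subspace_diff)
    moreover have "b - (a + b - c) \<in> V (p + 1)" using that assms sub by (blast intro: subspace_diff)
    ultimately have "c - a \<in> V p \<inter> V (p + 1)" by simp
    moreover have "V p \<inter> V (p + 1) = {0}"
      using assms(1) by (cases p) (auto simp: super_grading_def)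
    ultimately have "c - a \<in> {0}" by (simp only:)
    then show ?thesis by simp
  qed
  then show ?thesis unfolding component_def using assms by (intro the_equality) auto
qed

lemma component_homogeneous:
  assumes "super_grading V" "x \<in> V q" shows "component V p x = (if p = q then x else 0)"
proof -
  have "0 \<in> V r" for r using assms by (simp add: super_grading_def subspace_0)
  moreover have "q = p + 1" if "p \<noteq> q" using that by (cases p; cases q) auto
  ultimately show ?thesis
    using component_eq[OF assms(1), of x p 0] component_eq[OF assms(1), of 0 p x] assms by auto
qed

context lie_superalgebra
begin

lemma subspace_L: "subspace (L p)"
  using grading by (simp add: super_grading_def)

lemma zero_L [simp]: "0 \<in> L p"
  using subspace_L by (rule subspace_0)

lemmas br_simps = bilinear_ladd[OF bilinear] bilinear_radd[OF bilinear]
  bilinear_lmul[OF bilinear] bilinear_rmul[OF bilinear]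
  bilinear_lzero[OF bilinear] bilinear_rzero[OF bilinear]

lemma br_sum: "br (sum f A) z = (\<Sum>a\<in>A. br (f a) z)" "br z (sum f A) = (\<Sum>a\<in>A. br z (f a))"
  using bilinear unfolding bilinear_def
  by (auto simp: linear_sum linear_sum[where f = "\<lambda>x. br x z"])

end

lemma current_bracket_homogeneous:
  fixes L :: "bit \<Rightarrow> 'k::euclidean_space set" and X Y :: "'k ^ 's::{finite,linorder} set"
  assumes "lie_superalgebra L br" "X \<in> current_grading L p"
  shows "current_bracket L br X Y $ M = (\<Sum>I\<in>Pow M.
     (ksign (of_nat (card I) + p) (of_nat (card (M - I))) * gsign I (M - I)) *\<^sub>R
       br (X $ I) (Y $ (M - I)))"
proof -
  interpret lie_superalgebra L br by fact
  have "component L q (X $ I) = (if q = of_nat (card I) + p then X $ I else 0)" for q I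
    using component_homogeneous[OF grading] assms(2) unfolding current_grading_def by blast
  moreover have "(\<Sum>q\<in>{0, 1}. (ksign q t * g) *\<^sub>R br (if q = r then x else 0) y) =
     (ksign r t * g) *\<^sub>R br x y" for t g x y r
    by (cases r) (auto simp: br_simps)
  ultimately show ?thesis
    unfolding current_bracket_def vec_lambda_beta by (simp only:)
qed

text \<open>The defining formula \<open>[a \<otimes> x, b \<otimes> y] = (-1)\<^bsup>|x||b|\<^esup> ab \<otimes> [x, y]\<close>.\<close>

lemma current_bracket_tensor:
  assumes "lie_superalgebra L br" "x \<in> L p" "b \<in> grassmann_grading q"
  shows "current_bracket L br (a \<otimes>\<^sub>\<Lambda> x) (b \<otimes>\<^sub>\<Lambda> y) = ksign p q *\<^sub>R ((a \<bullet>\<^sub>\<Lambda> b) \<otimes>\<^sub>\<Lambda> br x y)"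
proof -
  interpret lie_superalgebra L br by fact
  have "c *\<^sub>R x \<in> L p" for c using assms subspace_L by (simp add: subspace_scale)
  then have "component L r (c *\<^sub>R x) = (if r = p then c *\<^sub>R x else 0)" for r c
    using component_homogeneous[OF grading] by blast
  then have *: "(\<Sum>r\<in>{0, 1}. (ksign r t * g) *\<^sub>R br (component L r (c *\<^sub>R x)) z) =
     (ksign p t * g * c) *\<^sub>R br x z" for t g c z
    by (cases p) (auto simp: br_simps)
  have "ksign p (of_nat (card I)) * b $ I = ksign p q * b $ I" for I
    using assms(3) by (cases "b $ I = 0") (auto simp: grassmann_grading_def)
  then have **: "ksign p (of_nat (card J)) * g * c * b $ J = ksign p q * (g * c * b $ J)" for J g c
    by (metis (no_types, lifting) mult.assoc mult.commute)
  show ?thesis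
    unfolding vec_eq_iff current_bracket_def tensor_def gmult_def
    by (simp only: vec_lambda_beta *)
       (simp add: br_simps ** scaleR_sum_left scaleR_sum_right sum_distrib_left)
qed

lemma ksign_mult: "ksign (p + q) r = ksign p r * ksign q r" "ksign r (p + q) = ksign r p * ksign r q"
  by (cases p; cases q; cases r; simp add: ksign_def)+

lemma of_nat_card_split:
  "I \<subseteq> M \<Longrightarrow> (of_nat (card M) :: bit) = of_nat (card I) + of_nat (card (M - I))" for M :: "'s::finite set"
  by (metis card_Diff_subset card_mono finite le_add_diff_inverse of_nat_add)

lemma super_grading_current:
  assumes "super_grading L"
  shows "super_grading (current_grading L :: bit \<Rightarrow> ('k::euclidean_space ^ 's::{finite,linorder} set) set)"
proof -
  have sub: "subspace (L p)" for p using assms by (simp add: super_grading_def)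
  have "subspace (current_grading L p :: ('k ^ 's set) set)" for p
    using sub by (auto simp: current_grading_def subspace_def)
  moreover have "current_grading L 0 \<inter> current_grading L 1 = {0 :: 'k ^ 's set}"
  proof -
    have "x = 0" if "x \<in> L c" "x \<in> L (c + 1)" for x c
      using that assms by (cases c) (auto simp: super_grading_def)
    then show ?thesis using sub
      by (auto simp: current_grading_def vec_eq_iff subspace_0 simp del: add_bit_eq_xor) metis
  qed
  moreover have "\<exists>a\<in>current_grading L 0. \<exists>b\<in>current_grading L 1. v = a + b" for v :: "'k ^ 's set"
  proof -
    have "\<exists>a b. a \<in> L c \<and> b \<in> L (c + 1) \<and> x = a + b" for x c
    proof -
      obtain a b where "a \<in> L 0" "b \<in> L 1" "x = a + b" using assms by (metis super_grading_def)
      then show ?thesis by (cases c) (auto simp: add.commute)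
    qed
    then obtain f g where fg: "f c x \<in> L c" "g c x \<in> L (c + 1)" "x = f c x + g c x" for c x by metis
    let ?a = "\<chi> I. f (of_nat (card I)) (v $ I)" and ?b = "\<chi> I. g (of_nat (card I)) (v $ I)"
    have "?a \<in> current_grading L 0" "?b \<in> current_grading L 1" using fg by (auto simp: current_grading_def)
    moreover have "v = ?a + ?b" using fg by (simp add: vec_eq_iff)
    ultimately show ?thesis by blast
  qed
  ultimately show ?thesis by (simp add: super_grading_def)
qed

lemma linear_component:
  assumes "super_grading V" shows "linear (component V p)"
proof -
  have sub: "subspace (V q)" for q using assms by (simp add: super_grading_def)
  have ex: "\<exists>a b. a \<in> V p \<and> b \<in> V (p + 1) \<and> x = a + b" for x
  proof -
    obtain a b where "a \<in> V 0" "b \<in> V 1" "x = a + b" using assms by (metis super_grading_def)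
    then show ?thesis by (cases p) (auto simp: add.commute)
  qed
  show ?thesis
  proof (rule linearI)
    fix x y
    obtain a b c d where *: "a \<in> V p" "b \<in> V (p + 1)" "x = a + b" "c \<in> V p" "d \<in> V (p + 1)" "y = c + d"
      using ex by metis
    moreover have "x + y = (a + c) + (b + d)" using * by simp
    moreover have "component V p ((a + c) + (b + d)) = a + c"
      by (rule component_eq[OF assms]) (use * sub in \<open>auto intro: subspace_add\<close>)
    ultimately show "component V p (x + y) = component V p x + component V p y"
      using component_eq[OF assms] by (simp only:)
  next
    fix r x
    obtain a b where *: "a \<in> V p" "b \<in> V (p + 1)" "x = a + b" using ex by metis
    moreover have "component V p (r *\<^sub>R a + r *\<^sub>R b) = r *\<^sub>R a"
      by (rule component_eq[OF assms]) (use * sub in \<open>auto intro: subspace_scale\<close>)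
    ultimately show "component V p (r *\<^sub>R x) = r *\<^sub>R component V p x"
      using component_eq[OF assms] by (simp add: scaleR_add_right)
  qed
qed

lemma lie_superalgebra_current:
  fixes L :: "bit \<Rightarrow> 'k::euclidean_space set"
  assumes "lie_superalgebra L br"
  shows "lie_superalgebra (current_grading L :: bit \<Rightarrow> ('k ^ 's::{finite,linorder} set) set) (current_bracket L br)"
proof -
  interpret lie_superalgebra L br by fact
  let ?B = "current_bracket L br :: 'k ^ 's set \<Rightarrow> _"
  note hom = current_bracket_homogeneous[OF assms]
  have closed: "?B X Y \<in> current_grading L (p + q)"
    if XY: "X \<in> current_grading L p" "Y \<in> current_grading L q" for X Y p q
  proof -
    have "br (X $ I) (Y $ (M - I)) \<in> L (of_nat (card M) + (p + q))" if "I \<subseteq> M" for I M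
      using br_closed[of "X $ I" "of_nat (card I) + p" "Y $ (M - I)" "of_nat (card (M - I)) + q"] XY
      by (simp add: current_grading_def of_nat_card_split[OF that] ac_simps del: add_bit_eq_xor)
    then show ?thesis unfolding current_grading_def
      by (auto simp: hom[OF XY(1)] simp del: add_bit_eq_xor intro!: subspace_sum subspace_scale subspace_L)
  qed
  show ?thesis
  proof
    show "super_grading (current_grading L :: bit \<Rightarrow> ('k ^ 's set) set)"
      by (rule super_grading_current[OF grading])
    have lin: "linear (component L p)" for p by (rule linear_component[OF grading])
    show "bilinear ?B"
      unfolding bilinear_def current_bracket_def
      by (intro conjI allI linearI; simp add: vec_eq_iff linear_add[OF lin] linear_scale[OF lin] br_simps
         sum.distrib scaleR_sum_right algebra_simps)
  next
    fix X Y :: "'k ^ 's set" and p q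
    assume XY: "X \<in> current_grading L p" "Y \<in> current_grading L q"
    show "?B X Y \<in> current_grading L (p + q)" using closed XY by blast
    have "?B X Y $ M = - (ksign p q *\<^sub>R ?B Y X) $ M" for M
    proof -
      have "?B X Y $ M = (\<Sum>J\<in>Pow M.
         (ksign (of_nat (card (M - J)) + p) (of_nat (card J)) * gsign (M - J) J) *\<^sub>R br (X $ (M - J)) (Y $ J))"
        using sum_Pow_swap[of "\<lambda>I J. (ksign (of_nat (card I) + p) (of_nat (card J)) * gsign I J) *\<^sub>R br (X $ I) (Y $ J)" M]
        by (simp add: hom[OF XY(1)])
      also have "\<dots> = (\<Sum>J\<in>Pow M. - (ksign p q *\<^sub>R
         ((ksign (of_nat (card J) + q) (of_nat (card (M - J))) * gsign J (M - J)) *\<^sub>R br (Y $ J) (X $ (M - J)))))"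
      proof (rule sum.cong)
        fix J assume "J \<in> Pow M"
        have d: "J \<inter> (M - J) = {}" by auto
        have "X $ (M - J) \<in> L (of_nat (card (M - J)) + p)" "Y $ J \<in> L (of_nat (card J) + q)"
          using XY by (auto simp: current_grading_def)
        note sk = br_skew[OF this]
        have e: "ksign (m + p) j * ksign j m * ksign (m + p) (j + q) = ksign p q * ksign (j + q) m" for m j
          by (cases m; cases j; cases p; cases q; simp add: ksign_def)
        show "(ksign (of_nat (card (M - J)) + p) (of_nat (card J)) * gsign (M - J) J) *\<^sub>R br (X $ (M - J)) (Y $ J) =
          - (ksign p q *\<^sub>R
         ((ksign (of_nat (card J) + q) (of_nat (card (M - J))) * gsign J (M - J)) *\<^sub>R br (Y $ J) (X $ (M - J))))"
          unfolding sk gsign_swap[OF d]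
          using e[of "of_nat (card (M - J))" "of_nat (card J)"]
          by (simp add: algebra_simps)
      qed simp
      finally show ?thesis by (simp add: hom[OF XY(2)] scaleR_sum_right sum_negf)
    qed
    then show "?B X Y = - (ksign p q *\<^sub>R ?B Y X)" by (simp add: vec_eq_iff)
  next
    fix X Y Z :: "'k ^ 's set" and p q r
    assume X: "X \<in> current_grading L p" and Y: "Y \<in> current_grading L q" and Z: "Z \<in> current_grading L r"
    let ?n = "\<lambda>I. of_nat (card I) :: bit"
    let ?c = "\<lambda>p q I J K. ksign (?n I + p) (?n J) * ksign (?n I + p) (?n K) * ksign (?n J + q) (?n K) *
       (gsign I J * gsign I K * gsign J K)"
    let ?f = "\<lambda>I J K. ?c p q I J K *\<^sub>R br (X $ I) (br (Y $ J) (Z $ K))"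
    let ?g = "\<lambda>I J K. ?c p q I J K *\<^sub>R br (br (X $ I) (Y $ J)) (Z $ K)"
    have right: "?B U (?B V W) $ M = (\<Sum>I\<in>Pow M. \<Sum>J\<in>Pow (M - I).
        ?c a b I J (M - I - J) *\<^sub>R br (U $ I) (br (V $ J) (W $ (M - I - J))))"
      if U: "U \<in> current_grading L a" and V: "V \<in> current_grading L b" for U V W a b M
    proof -
      have "gsign I (M - I) = gsign I J * gsign I (M - I - J)"
        "ksign t (?n (M - I)) = ksign t (?n J) * ksign t (?n (M - I - J))" if "J \<subseteq> M - I" for I J t
        using gsign_Un_right[of J "M - I - J" I] that of_nat_card_split[OF that]
        by (simp_all add: Un_absorb1 ksign_mult del: add_bit_eq_xor)
      then show ?thesis
        unfolding hom[OF U] hom[OF V] by (auto simp: br_simps br_sum scaleR_sum_right algebra_simps intro!: sum.cong)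
    qed
    have left: "?B (?B X Y) Z $ M = (\<Sum>K\<in>Pow M. \<Sum>I\<in>Pow K. ?g I (K - I) (M - K))" for M
    proof -
      have "gsign K (M - K) = gsign I (M - K) * gsign (K - I) (M - K)"
        "ksign (?n K + (p + q)) t = ksign (?n I + p) t * ksign (?n (K - I) + q) t" if "I \<subseteq> K" for I K t
        using gsign_Un_left[of I "K - I" "M - K"] that of_nat_card_split[OF that]
        by (simp_all add: Un_absorb1 ksign_mult del: add_bit_eq_xor)
      then show ?thesis
        unfolding hom[OF closed[OF X Y]] hom[OF X]
        by (auto simp: br_simps br_sum scaleR_sum_right algebra_simps intro!: sum.cong)
    qed
    let ?h = "\<lambda>I J K. (ksign p q * ?c q p J I K) *\<^sub>R br (Y $ J) (br (X $ I) (Z $ K))"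
    have "?B X (?B Y Z) $ M = (?B (?B X Y) Z + ksign p q *\<^sub>R ?B Y (?B X Z)) $ M" for M
    proof -
      have jac: "?f I J K = ?g I J K + ?h I J K" if d: "I \<inter> J = {}" for I J K
      proof -
        have h: "X $ I \<in> L (?n I + p)" "Y $ J \<in> L (?n J + q)" "Z $ K \<in> L (?n K + r)"
          using X Y Z by (auto simp: current_grading_def)
        have e: "ksign (i + p) j * ksign (i + p) (j + q) = ksign p q * ksign (j + q) i * ksign i j" for i j
          by (cases i; cases j; cases p; cases q; simp add: ksign_def)
        have "?c p q I J K * ksign (?n I + p) (?n J + q) = ksign p q * ?c q p J I K"
          using e[of "?n I" "?n J"] unfolding gsign_swap[OF d] by (simp add: algebra_simps)
        then show ?thesis using br_jacobi[OF h] by (simp add: scaleR_add_right)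
      qed
      have "?B X (?B Y Z) $ M = (\<Sum>I\<in>Pow M. \<Sum>J\<in>Pow (M - I). ?f I J (M - I - J))"
        by (rule right[OF X Y])
      also have "\<dots> = (\<Sum>I\<in>Pow M. \<Sum>J\<in>Pow (M - I). ?g I J (M - I - J)) +
          (\<Sum>I\<in>Pow M. \<Sum>J\<in>Pow (M - I). ?h I J (M - I - J))"
        unfolding sum.distrib[symmetric] by (intro sum.cong jac) auto
      also have "(\<Sum>I\<in>Pow M. \<Sum>J\<in>Pow (M - I). ?g I J (M - I - J)) = ?B (?B X Y) Z $ M"
        unfolding left by (rule sum_Pow_assoc)
      also have "(\<Sum>I\<in>Pow M. \<Sum>J\<in>Pow (M - I). ?h I J (M - I - J)) =
          (\<Sum>J\<in>Pow M. \<Sum>I\<in>Pow (M - J). ?h I J (M - J - I))"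
      proof -
        have "(\<Sum>(I, J)\<in>Sigma (Pow M) (\<lambda>I. Pow (M - I)). ?h I J (M - I - J)) =
              (\<Sum>(J, I)\<in>Sigma (Pow M) (\<lambda>J. Pow (M - J)). ?h I J (M - J - I))"
          by (rule sum.reindex_bij_witness[where i = prod.swap and j = prod.swap])
             (auto simp: Diff_eq Int_commute Int_left_commute Int_assoc)
        then show ?thesis by (simp add: sum.Sigma)
      qed
      also have "\<dots> = (ksign p q *\<^sub>R ?B Y (?B X Z)) $ M"
        by (simp add: right[OF Y X] scaleR_sum_right)
      finally show ?thesis by simp
    qed
    then show "?B X (?B Y Z) = ?B (?B X Y) Z + ksign p q *\<^sub>R ?B Y (?B X Z)" unfolding vec_eq_iff by blast
  qed
qed


lemma grassmann_plus_iff: "a \<in> grassmann_plus \<longleftrightarrow> a $ {} = 0"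
  for a :: "real ^ 's::{finite,linorder} set"
proof
  let ?Z = "{a :: real ^ 's set. a $ {} = 0}"
  have sub: "subspace ?Z" by (auto simp: subspace_def)
  have "grassmann_deg m \<subseteq> ?Z" if "m \<ge> 1" for m
    unfolding grassmann_deg_def
    by (rule span_minimal[OF _ sub]) (use that in \<open>auto simp: gprod_sorted axis_def\<close>)
  then have "grassmann_plus \<subseteq> ?Z"
    unfolding grassmann_plus_def by (intro span_minimal[OF _ sub]) auto
  then show "a \<in> grassmann_plus \<Longrightarrow> a $ {} = 0" by auto
next
  assume 0: "a $ {} = 0"
  have "axis I 1 \<in> (grassmann_plus :: (real ^ 's set) set)" if "I \<noteq> {}" for I
  proof -
    have "axis I 1 = gprod (sorted_list_of_set I)" by (simp add: gprod_sorted)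
    then have "axis I 1 \<in> (grassmann_deg (card I) :: (real ^ 's set) set)"
      unfolding grassmann_deg_def by (intro span_base) (use strict_sorted_list_of_set in force)
    moreover have "card I \<ge> 1" using that by (simp add: Suc_le_eq card_gt_0_iff)
    ultimately show ?thesis unfolding grassmann_plus_def by (intro span_base) auto
  qed
  then have "(a $ I) *\<^sub>R axis I 1 \<in> grassmann_plus" for I
    using 0 unfolding grassmann_plus_def by (cases "I = {}") (auto intro: span_scale span_zero)
  then have "(\<Sum>I\<in>UNIV. (a $ I) *\<^sub>R axis I 1) \<in> grassmann_plus"
    unfolding grassmann_plus_def by (intro span_sum) auto
  then show "a \<in> grassmann_plus"
    using basis_expansion[of a] by (simp add: scalar_mult_eq_scaleR)
qed

lemma current_plus_iff: "X \<in> current_plus \<longleftrightarrow> X $ {} = 0"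
  for X :: "'k::euclidean_space ^ 's::{finite,linorder} set"
proof
  let ?Z = "{X :: 'k ^ 's set. X $ {} = 0}"
  have sub: "subspace ?Z" by (auto simp: subspace_def)
  have "current_plus \<subseteq> ?Z"
    unfolding current_plus_def
    by (intro span_minimal[OF _ sub]) (auto simp: tensor_def grassmann_plus_iff)
  then show "X \<in> current_plus \<Longrightarrow> X $ {} = 0" by auto
next
  assume 0: "X $ {} = 0"
  have "axis I 1 \<otimes>\<^sub>\<Lambda> X $ I \<in> current_plus" for I
  proof (cases "I = {}")
    case True
    then show ?thesis using 0 by (simp add: tensor_def current_plus_def span_zero flip: zero_vec_def)
  next
    case False
    then have "axis I 1 \<in> (grassmann_plus :: (real ^ 's set) set)" by (simp add: grassmann_plus_iff axis_def)
    then show ?thesis unfolding current_plus_def by (intro span_base) blast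
  qed
  then have "(\<Sum>I\<in>UNIV. axis I 1 \<otimes>\<^sub>\<Lambda> X $ I) \<in> current_plus"
    unfolding current_plus_def by (intro span_sum) auto
  moreover have "(\<Sum>I\<in>UNIV. axis I 1 \<otimes>\<^sub>\<Lambda> X $ I) = X"
    by (simp add: vec_eq_iff tensor_def axis_def if_distrib[of "\<lambda>c. c *\<^sub>R _"] cong: if_cong)
  ultimately show "X \<in> current_plus" by simp
qed

lemma group_aut_group:
  assumes "lie_superalgebra L br"
  shows "group (aut_group L br)"
proof -
  interpret lie_superalgebra L br by fact
  have inverse: "\<exists>B\<in>lie_aut L br. B o\<^sub>L A = id_blinfun" if A: "A \<in> lie_aut L br" for A
  proof -
    let ?f = "blinfun_apply A" and ?g = "inv_into UNIV (blinfun_apply A)"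
    have bij: "bij ?f" using A by (simp add: lie_aut_def)
    then have fg: "?f (?g x) = x" and gf: "?g (?f x) = x" for x
      by (simp_all add: bij_is_surj surj_f_inv_f bij_is_inj inv_f_f)
    have "linear ?g"
      by (rule linearI) (metis fg gf blinfun.add_right, metis fg gf blinfun.scaleR_right)
    then have app: "blinfun_apply (Blinfun ?g) = ?g"
      by (simp add: bounded_linear_Blinfun_apply linear_conv_bounded_linear)
    have "?g x \<in> L p" if x: "x \<in> L p" for p x
    proof -
      obtain a b where ab: "a \<in> L p" "b \<in> L (p + 1)" "?g x = a + b"
      proof -
        obtain a b where "a \<in> L 0" "b \<in> L 1" "?g x = a + b" using grading by (metis super_grading_def)
        then show ?thesis using that by (cases p) (auto simp: add.commute)
      qed
      have "?f a \<in> L p" "?f b \<in> L (p + 1)" using A ab(1,2) by (auto simp only: lie_aut_def)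
      moreover have "x = ?f a + ?f b" using fg[of x] ab(3) by (simp add: blinfun.add_right)
      ultimately have "component L p x = ?f a" using component_eq[OF grading] by (simp only:)
      moreover have "component L p x = x" using component_homogeneous[OF grading x] by simp
      ultimately show ?thesis using ab(1) gf by metis
    qed
    moreover have "?g (br x y) = br (?g x) (?g y)" for x y
    proof -
      have "?f (br (?g x) (?g y)) = br x y" using A fg by (simp add: lie_aut_def)
      then show ?thesis using gf by metis
    qed
    ultimately have "Blinfun ?g \<in> lie_aut L br"
      using bij_imp_bij_inv[OF bij] by (auto simp: lie_aut_def app)
    moreover have "Blinfun ?g o\<^sub>L A = id_blinfun"
      by (rule blinfun_eqI) (simp add: app gf)
    ultimately show ?thesis by blast
  qed
  show ?thesis
  proof (rule groupI)
    fix A B assume "A \<in> carrier (aut_group L br)" "B \<in> carrier (aut_group L br)"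
    moreover have "blinfun_apply (A o\<^sub>L B) = blinfun_apply A \<circ> blinfun_apply B" by auto
    ultimately show "A \<otimes>\<^bsub>aut_group L br\<^esub> B \<in> carrier (aut_group L br)"
      unfolding aut_group_def lie_aut_def by (auto simp: image_subset_iff intro: bij_comp)
  next
    show "\<one>\<^bsub>aut_group L br\<^esub> \<in> carrier (aut_group L br)"
      by (auto simp: aut_group_def lie_aut_def bij_def inj_def surj_def)
  qed (use inverse in \<open>auto simp: aut_group_def intro!: blinfun_eqI\<close>)
qed

end

theory Submission
  imports Defs
begin

text \<open>The proof rests on the observation that an odd element \<open>X\<close> with \<open>[X, X] = 0\<close> acts by zero in
  every unitary representation \<open>\<rho>\<close>: the bracket relation gives \<open>\<rho>(X)\<^sup>2 = 0\<close>, and \<open>\<rho>(X)\<close> is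
  self-adjoint up to a scalar of modulus one, so \<open>\<parallel>\<rho>(X)v\<parallel>\<^sup>2\<close> is a multiple of
  \<open>\<langle>v, \<rho>(X)\<^sup>2v\<rangle> = 0\<close> (\<open>odd_null_in_rep_kernel\<close>).  The elements \<open>\<epsilon>\<^sub>i \<otimes> x\<close> with \<open>x\<close> even are
  of this kind, because \<open>\<epsilon>\<^sub>i\<^sup>2 = 0\<close>.

  The kernel of \<open>\<rho>\<close> is a graded ideal (\<open>graded_ideal_rep_kernel\<close>), and for every graded ideal \<open>K\<close>
  of \<open>\<Lambda>\<^sub>s(\<real>) \<otimes> \<kk>\<close> and every index set \<open>I\<close> the elements \<open>x\<close> with \<open>\<epsilon>\<^sub>I \<otimes> x \<in> K\<close> form a graded
  ideal of \<open>\<kk>\<close> (\<open>graded_ideal_coefficients\<close>).  By simplicity of \<open>\<kk>\<close> such an ideal is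
  \<open>{0}\<close> or \<open>\<kk>\<close>.  If \<open>K\<close> is the kernel and \<open>I = {i}\<close>, it contains \<open>\<kk>\<^sub>0\<close>, which cannot vanish since otherwise all brackets
  in \<open>\<kk>\<close> would; hence \<open>\<epsilon>\<^sub>i \<otimes> \<kk>\<close> lies in the kernel.  For an arbitrary \<open>I\<close> containing \<open>i\<close> the
  ideal contains all brackets of \<open>\<kk>\<close>, since for homogeneous \<open>x\<close> the element \<open>\<epsilon>\<^sub>I \<otimes> [x, y]\<close> is up to sign the bracket of \<open>\<epsilon>\<^sub>i \<otimes> x\<close> with
  \<open>\<epsilon>\<^bsub>I - {i}\<^esub> \<otimes> y\<close>; so again it is all of \<open>\<kk>\<close>.

  For the correspondence, \<open>x \<mapsto> 1 \<otimes> x\<close> and the projection \<open>X \<mapsto> X $ {}\<close> along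
  \<open>\<Lambda>\<^sub>s\<^sup>+(\<real>) \<otimes> \<kk>\<close> are even homomorphisms.  Composing with them transports unitary representations
  in both directions; the two operations are mutually inverse because \<open>X - 1 \<otimes> X $ {}\<close> lies in
  \<open>\<Lambda>\<^sub>s\<^sup>+(\<real>) \<otimes> \<kk>\<close>, on which every unitary representation vanishes.\<close>

section \<open>Gradings and graded ideals\<close>

lemma super_grading_decomp:
  assumes "super_grading V"
  obtains a b where "a \<in> V p" "b \<in> V (p + 1)" "v = a + b"
proof -
  obtain a b where "a \<in> V 0" "b \<in> V 1" "v = a + b" using assms by (metis super_grading_def)
  then show thesis using that by (cases p) (auto simp: add.commute)
qed

lemma graded_ideal_components:
  assumes "super_grading V" "graded_ideal V B K" "a + b \<in> K" "a \<in> V p" "b \<in> V (p + 1)"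
  shows "a \<in> K" "b \<in> K"
proof -
  obtain c d where cd: "c \<in> K \<inter> V 0" "d \<in> K \<inter> V 1" "a + b = c + d"
    using assms(2,3) by (metis graded_ideal_def)
  obtain c' d' where *: "c' \<in> K" "c' \<in> V p" "d' \<in> V (p + 1)" "d' \<in> K" "a + b = c' + d'"
    using cd by (cases p) (auto simp: add.commute)
  have "a = c'"
    using component_eq[OF assms(1,4,5)] component_eq[OF assms(1) *(2,3)] *(5) by (simp only:)
  then show "a \<in> K" "b \<in> K" using * by auto
qed

lemma simple_even_part_nonzero:
  assumes "simple_lie_superalgebra L br"
  shows "L 0 \<noteq> {0}"
proof
  assume L0: "L 0 = {0}"
  interpret lie_superalgebra L br using assms by (simp add: simple_lie_superalgebra_def)
  have odd: "x \<in> L 1" for x using grading L0 by (auto simp: super_grading_def)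
  have "br x y = 0" for x y using br_closed[OF odd odd, of x y] L0 by simp
  then show False using assms by (auto simp: simple_lie_superalgebra_def)
qed

section \<open>Coefficients of current superalgebras\<close>

lemma tensor_linear:
  "a \<otimes>\<^sub>\<Lambda> (x + y) = a \<otimes>\<^sub>\<Lambda> x + a \<otimes>\<^sub>\<Lambda> y" "a \<otimes>\<^sub>\<Lambda> (r *\<^sub>R x) = r *\<^sub>R (a \<otimes>\<^sub>\<Lambda> x)" "a \<otimes>\<^sub>\<Lambda> 0 = 0"
  "(r *\<^sub>R a) \<otimes>\<^sub>\<Lambda> x = r *\<^sub>R (a \<otimes>\<^sub>\<Lambda> x)"
  by (simp_all add: tensor_def vec_eq_iff scaleR_add_right)

lemma axis_in_grassmann_grading: "axis I c \<in> grassmann_grading (of_nat (card I))"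
  by (simp add: grassmann_grading_def axis_def)

lemma axis_tensor_in_current_grading:
  assumes "lie_superalgebra L br" "x \<in> L p"
  shows "axis I c \<otimes>\<^sub>\<Lambda> x \<in> current_grading L (of_nat (card I) + p)"
proof -
  interpret lie_superalgebra L br by fact
  have "of_nat (card I) + (of_nat (card I) + p) = p" by (cases "of_nat (card I) :: bit"; cases p) auto
  then show ?thesis
    using assms(2) subspace_scale[OF subspace_L]
    by (auto simp: current_grading_def tensor_def axis_def simp del: add_bit_eq_xor)
qed

text \<open>The Koszul sign \<open>(-1)\<^bsup>|x||1|\<^esup>\<close> is \<open>1\<close> for even and for odd \<open>x\<close>, so the formula extends
  additively to all \<open>x\<close>.\<close>

lemma current_bracket_tensor_one:
  assumes "lie_superalgebra L br"
  shows "current_bracket L br (a \<otimes>\<^sub>\<Lambda> x) (\<one>\<^sub>\<Lambda> \<otimes>\<^sub>\<Lambda> y) = a \<otimes>\<^sub>\<Lambda> br x y"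
proof -
  interpret lie_superalgebra L br by fact
  interpret current: lie_superalgebra "current_grading L" "current_bracket L br"
    by (rule lie_superalgebra_current[OF assms])
  have one: "\<one>\<^sub>\<Lambda> \<in> grassmann_grading 0"
    using axis_in_grassmann_grading[of "{}" 1] by (simp add: gone_def)
  obtain x0 x1 where "x0 \<in> L 0" "x1 \<in> L (0 + 1)" "x = x0 + x1"
    by (rule super_grading_decomp[OF grading])
  then show ?thesis
    using current_bracket_tensor[OF assms _ one, of x0 0 a y] current_bracket_tensor[OF assms _ one, of x1 1 a y]
    by (simp add: tensor_linear current.br_simps br_simps ksign_def)
qed

text \<open>Bracketing with \<open>1 \<otimes> \<kk>\<close> keeps \<open>\<epsilon>\<^sub>I\<close> fixed up to sign, and the homogeneous components of
  \<open>\<epsilon>\<^sub>I \<otimes> x\<close> are \<open>\<epsilon>\<^sub>I\<close> tensored with those of \<open>x\<close>, their degrees shifted by \<open>|I|\<close>.\<close>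

lemma graded_ideal_coefficients:
  fixes L :: "bit \<Rightarrow> 'k::euclidean_space set" and K :: "('k ^ 's::{finite,linorder} set) set"
  assumes lie: "lie_superalgebra L br"
    and K: "graded_ideal (current_grading L) (current_bracket L br) K"
  shows "graded_ideal L br {x. axis I 1 \<otimes>\<^sub>\<Lambda> x \<in> K}"
proof -
  interpret lie_superalgebra L br by fact
  have sub: "subspace K" using K by (simp add: graded_ideal_def)
  note K_closed = subspace_0[OF sub] subspace_add[OF sub] subspace_scale[OF sub]
  have bracket: "current_bracket L br X Y \<in> K" "current_bracket L br Y X \<in> K" if "Y \<in> K" for X Y
    using K that by (auto simp: graded_ideal_def)
  show ?thesis
    unfolding graded_ideal_def
  proof (intro conjI allI ballI)
    show "subspace {x. axis I 1 \<otimes>\<^sub>\<Lambda> x \<in> K}"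
      by (auto simp: subspace_def tensor_linear K_closed)
  next
    fix x assume x: "x \<in> {x. axis I 1 \<otimes>\<^sub>\<Lambda> x \<in> K}"
    obtain a b where ab: "a \<in> L 0" "b \<in> L (0 + 1)" "x = a + b" by (rule super_grading_decomp[OF grading])
    then have "axis I 1 \<otimes>\<^sub>\<Lambda> a + axis I 1 \<otimes>\<^sub>\<Lambda> b \<in> K" using x by (simp add: tensor_linear)
    note graded_ideal_components[OF super_grading_current[OF grading] K this, of "of_nat (card I)"]
    moreover have "axis I 1 \<otimes>\<^sub>\<Lambda> a \<in> (current_grading L (of_nat (card I)) :: ('k ^ 's set) set)"
      "axis I 1 \<otimes>\<^sub>\<Lambda> b \<in> (current_grading L (of_nat (card I) + 1) :: ('k ^ 's set) set)"
      using axis_tensor_in_current_grading[OF lie ab(1), of I 1]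
        axis_tensor_in_current_grading[OF lie ab(2), of I 1] by (simp_all del: add_bit_eq_xor)
    ultimately show "\<exists>a\<in>{x. axis I 1 \<otimes>\<^sub>\<Lambda> x \<in> K} \<inter> L 0. \<exists>b\<in>{x. axis I 1 \<otimes>\<^sub>\<Lambda> x \<in> K} \<inter> L 1. x = a + b"
      using ab by auto
  next
    fix x y assume y: "y \<in> {x. axis I 1 \<otimes>\<^sub>\<Lambda> x \<in> K}"
    have hom: "axis I 1 \<otimes>\<^sub>\<Lambda> br z y \<in> K" if z: "z \<in> L p" for z p
    proof -
      let ?c = "ksign p (of_nat (card I))"
      have "?c *\<^sub>R (axis I 1 \<otimes>\<^sub>\<Lambda> br z y) \<in> K"
        using bracket(1)[of "axis I 1 \<otimes>\<^sub>\<Lambda> y" "\<one>\<^sub>\<Lambda> \<otimes>\<^sub>\<Lambda> z"] y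
          current_bracket_tensor[OF lie z axis_in_grassmann_grading, of "\<one>\<^sub>\<Lambda>" I 1 y] by simp
      moreover have "?c * ?c = 1" by (simp add: ksign_def)
      ultimately show ?thesis using K_closed(3)[of _ ?c] by (metis scaleR_scaleR scaleR_one)
    qed
    obtain a b where ab: "a \<in> L 0" "b \<in> L (0 + 1)" "x = a + b" by (rule super_grading_decomp[OF grading])
    show "br x y \<in> {x. axis I 1 \<otimes>\<^sub>\<Lambda> x \<in> K}"
      using hom[OF ab(1)] hom[OF ab(2)] by (simp add: ab(3) br_simps tensor_linear K_closed)
    show "br y x \<in> {x. axis I 1 \<otimes>\<^sub>\<Lambda> x \<in> K}"
      using bracket(2)[of "axis I 1 \<otimes>\<^sub>\<Lambda> y" "\<one>\<^sub>\<Lambda> \<otimes>\<^sub>\<Lambda> x"] y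
      by (simp add: current_bracket_tensor_one[OF lie])
  qed
qed

text \<open>An ideal that contains \<open>\<epsilon>\<^sub>i \<otimes> \<kk>\<^sub>0\<close> for all \<open>i\<close> already contains \<open>\<Lambda>\<^sub>s\<^sup>+(\<real>) \<otimes> \<kk>\<close>: the
  coefficient ideals are nonzero, because \<open>\<kk>\<^sub>0 \<noteq> {0}\<close> for singletons and because some bracket of
  \<open>\<kk>\<close> is nonzero for larger index sets.\<close>

lemma current_plus_subset_graded_ideal:
  fixes L :: "bit \<Rightarrow> 'k::euclidean_space set" and K :: "('k ^ 's::{finite,linorder} set) set"
  assumes simple: "simple_lie_superalgebra L br"
    and K: "graded_ideal (current_grading L) (current_bracket L br) K"
    and even: "\<And>i x. x \<in> L 0 \<Longrightarrow> eps i \<otimes>\<^sub>\<Lambda> x \<in> K"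
  shows "current_plus \<subseteq> K"
proof -
  have lie: "lie_superalgebra L br" using simple by (simp add: simple_lie_superalgebra_def)
  interpret lie_superalgebra L br by fact
  have sub: "subspace K" using K by (simp add: graded_ideal_def)
  have full: "axis I 1 \<otimes>\<^sub>\<Lambda> z \<in> K" if "axis I 1 \<otimes>\<^sub>\<Lambda> y \<in> K" "y \<noteq> 0" for I y z
  proof -
    have "{x. axis I 1 \<otimes>\<^sub>\<Lambda> x \<in> K} \<noteq> {0}" using that by auto
    then have "{x. axis I 1 \<otimes>\<^sub>\<Lambda> x \<in> K} = UNIV"
      using simple graded_ideal_coefficients[OF lie K] by (simp only: simple_lie_superalgebra_def) blast
    then show ?thesis by auto
  qed
  have gen: "eps i \<otimes>\<^sub>\<Lambda> z \<in> K" for i z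
    using simple_even_part_nonzero[OF simple] even zero_L[of 0] full[of "{i}" _ z] by (auto simp: eps_def)
  have nonempty: "axis I 1 \<otimes>\<^sub>\<Lambda> z \<in> K" if I: "I \<noteq> {}" for I z
  proof -
    obtain i where i: "i \<in> I" using I by blast
    let ?J = "I - {i}"
    obtain x y where xy: "br x y \<noteq> 0" using simple by (auto simp: simple_lie_superalgebra_def)
    obtain x0 x1 where x: "x0 \<in> L 0" "x1 \<in> L (0 + 1)" "x = x0 + x1"
      by (rule super_grading_decomp[OF grading])
    then have "br x0 y \<noteq> 0 \<or> br x1 y \<noteq> 0" using xy by (auto simp: br_simps)
    then obtain p w where w: "w \<in> L p" "br w y \<noteq> 0" using x by blast
    \<comment> \<open>the Koszul sign times the sign from reordering \<open>\<epsilon>\<^sub>i \<epsilon>\<^bsub>I - {i}\<^esub>\<close> into \<open>\<epsilon>\<^sub>I\<close>\<close>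
    define c where "c = ksign p (of_nat (card ?J)) * gsign {i} ?J"
    have "eps i \<bullet>\<^sub>\<Lambda> axis ?J 1 = gsign {i} ?J *\<^sub>R axis I 1"
      unfolding eps_def gmult_axis using i by (simp add: insert_absorb) (simp add: vec_eq_iff axis_def)
    then have "current_bracket L br (eps i \<otimes>\<^sub>\<Lambda> w) (axis ?J 1 \<otimes>\<^sub>\<Lambda> y) = c *\<^sub>R (axis I 1 \<otimes>\<^sub>\<Lambda> br w y)"
      using current_bracket_tensor[OF lie w(1) axis_in_grassmann_grading, of "eps i" ?J 1 y]
      by (simp add: tensor_linear c_def)
    then have "axis I 1 \<otimes>\<^sub>\<Lambda> (c *\<^sub>R br w y) \<in> K"
      using K gen[of i w] unfolding graded_ideal_def by (metis tensor_linear(2))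
    moreover have "c \<noteq> 0" by (simp add: c_def ksign_def gsign_def)
    ultimately show ?thesis using w(2) full by simp
  qed
  show ?thesis
  proof
    fix X :: "'k ^ 's set" assume "X \<in> current_plus"
    then have "X $ {} = 0" by (simp add: current_plus_iff)
    then have "axis I 1 \<otimes>\<^sub>\<Lambda> X $ I \<in> K" for I
      using nonempty[of I "X $ I"] subspace_0[OF sub] by (cases "I = {}") (auto simp: tensor_linear)
    then have "(\<Sum>I\<in>UNIV. axis I 1 \<otimes>\<^sub>\<Lambda> X $ I) \<in> K" by (intro subspace_sum[OF sub]) auto
    moreover have "(\<Sum>I\<in>UNIV. axis I 1 \<otimes>\<^sub>\<Lambda> X $ I) = X"
      by (simp add: vec_eq_iff tensor_def axis_def if_distrib[of "\<lambda>c. c *\<^sub>R _"] cong: if_cong)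
    ultimately show "X \<in> K" by simp
  qed
qed

section \<open>Unitary representations\<close>

context pre_hilbert_superspace
begin

lemma ip_zero_right: "ip u 0 = 0"
proof -
  have "ip 0 u = 0" using ip_add[of 0 0 u] by simp
  then show ?thesis using ip_cnj[of u 0] by simp
qed

lemma H_decomp_unique:
  assumes "a \<in> H p" "b \<in> H (p + 1)" "a + b = 0"
  shows "a = 0" "b = 0"
proof -
  have "a = - b" using assms(3) by (simp add: eq_neg_iff_add_eq_0)
  then have "a \<in> H p \<inter> H (p + 1)" using assms(1,2) subspace_neg[OF subspace_H] by blast
  moreover have "H p \<inter> H (p + 1) = {0}" using H_disjoint by (cases p) auto
  ultimately show "a = 0" by blast
  then show "b = 0" using assms(3) by simp
qed

text \<open>The adjoint of \<open>\<rho>(X)\<close> is \<open>-\<i>\<rho>(X)\<close>, so \<open>\<rho>(X)\<^sup>2 = 0\<close> forces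
  \<open>\<langle>\<rho>(X)v, \<rho>(X)v\<rangle> = \<langle>v, -\<i>\<rho>(X)\<^sup>2v\<rangle> = 0\<close>; the positive definiteness of the inner product
  is what excludes nilpotent operators here.\<close>

lemma odd_null_in_rep_kernel:
  assumes rep: "unitary_rep L br cscale H ip \<rho>" and X: "X \<in> L 1" and null: "br X X = 0"
  shows "X \<in> rep_kernel \<rho>"
proof -
  have "\<rho> (0 + 0) v = \<rho> 0 v + \<rho> 0 v" for v
    using rep unfolding unitary_rep_def by blast
  then have "\<rho> 0 v = 0" for v by simp
  moreover have "\<rho> (br X X) v = \<rho> X (\<rho> X v) - cscale (of_real (ksign 1 1)) (\<rho> X (\<rho> X v))" for v
    using rep X unfolding unitary_rep_def by blast
  ultimately have "\<rho> X (\<rho> X v) + \<rho> X (\<rho> X v) = 0" for v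
    by (simp add: null ksign_def)
  moreover have "w + w = cscale 2 w" for w using scale_left_distrib[of 1 1 w] by simp
  ultimately have sq: "\<rho> X (\<rho> X v) = 0" for v by simp
  have "ip (\<rho> X v) (\<rho> X v) = ip v (cscale (- (if (1::bit) = 1 then \<i> else 1)) (\<rho> X (\<rho> X v)))" for v
    using rep X unfolding unitary_rep_def by blast
  then have "ip (\<rho> X v) (\<rho> X v) = 0" for v by (simp add: sq ip_zero_right)
  then show ?thesis by (auto simp: rep_kernel_def intro: ip_definite)
qed

text \<open>The kernel is graded because an even and an odd operator on \<open>\<H>\<close> whose sum is zero both vanish:
  on a homogeneous vector their values lie in complementary subspaces.\<close>

lemma graded_ideal_rep_kernel:
  assumes lie: "lie_superalgebra L br" and rep: "unitary_rep L br cscale H ip \<rho>"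
  shows "graded_ideal L br (rep_kernel \<rho>)"
proof -
  interpret lie: lie_superalgebra L br by fact
  have lin: "Vector_Spaces.linear cscale cscale (\<rho> X)"
    and add: "\<rho> (X + Y) v = \<rho> X v + \<rho> Y v"
    and scale: "\<rho> (r *\<^sub>R X) v = cscale (of_real r) (\<rho> X v)" for X Y v r
    using rep by (simp_all add: unitary_rep_def)
  have op_add: "\<rho> X (u + v) = \<rho> X u + \<rho> X v" for X u v
    using lin[of X] by (simp add: Vector_Spaces.linear_iff)
  have op_zero: "\<rho> X 0 = 0" for X using op_add[of X 0 0] by simp
  have zero: "\<rho> 0 v = 0" for v using add[of 0 0 v] by simp
  have homogeneous: "\<rho> X v \<in> H (p + q)" if "X \<in> L p" "v \<in> H q" for X v p q
    using rep that by (auto simp: unitary_rep_def end_grading_def simp del: add_bit_eq_xor)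
  have sub: "real_vector.subspace (rep_kernel \<rho>)"
    by (auto simp: real_vector.subspace_def rep_kernel_def add scale zero)
  have parts: "a \<in> rep_kernel \<rho>" "b \<in> rep_kernel \<rho>"
    if "a + b \<in> rep_kernel \<rho>" and ab: "a \<in> L 0" "b \<in> L 1" for a b
  proof -
    have "\<rho> a v = 0 \<and> \<rho> b v = 0" if v: "v \<in> H q" for v q
    proof -
      have "\<rho> a v \<in> H q" "\<rho> b v \<in> H (q + 1)"
        using homogeneous[OF ab(1) v] homogeneous[OF ab(2) v] by (simp_all del: add_bit_eq_xor add: add.commute)
      moreover have "\<rho> a v + \<rho> b v = 0" using \<open>a + b \<in> rep_kernel \<rho>\<close> by (simp add: rep_kernel_def add)
      ultimately show ?thesis using H_decomp_unique by blast
    qed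
    then have "\<rho> a v = 0 \<and> \<rho> b v = 0" for v
      using H_sum[of v] by (auto simp: op_add)
    then show "a \<in> rep_kernel \<rho>" "b \<in> rep_kernel \<rho>" by (simp_all add: rep_kernel_def)
  qed
  have hom: "br X Y \<in> rep_kernel \<rho>" "br Y X \<in> rep_kernel \<rho>"
    if "Y \<in> rep_kernel \<rho>" "X \<in> L p" "Y \<in> L q" for X Y p q
  proof -
    have "\<rho> (br A B) v = \<rho> A (\<rho> B v) - cscale (of_real (ksign r s)) (\<rho> B (\<rho> A v))"
      if "A \<in> L r" "B \<in> L s" for A B r s v
      using rep that unfolding unitary_rep_def by blast
    then show "br X Y \<in> rep_kernel \<rho>" "br Y X \<in> rep_kernel \<rho>"
      using that by (simp_all add: rep_kernel_def op_zero)
  qed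
  show ?thesis
    unfolding graded_ideal_def
  proof (intro conjI allI ballI)
    show "real_vector.subspace (rep_kernel \<rho>)" by fact
  next
    fix X assume "X \<in> rep_kernel \<rho>"
    moreover obtain a b where "a \<in> L 0" "b \<in> L (0 + 1)" "X = a + b"
      by (rule super_grading_decomp[OF lie.grading])
    ultimately show "\<exists>a\<in>rep_kernel \<rho> \<inter> L 0. \<exists>b\<in>rep_kernel \<rho> \<inter> L 1. X = a + b"
      using parts[of a b] by auto
  next
    fix X Y assume Y: "Y \<in> rep_kernel \<rho>"
    obtain a b where X: "a \<in> L 0" "b \<in> L (0 + 1)" "X = a + b"
      by (rule super_grading_decomp[OF lie.grading])
    obtain c d where cd: "c \<in> L 0" "d \<in> L (0 + 1)" "Y = c + d"
      by (rule super_grading_decomp[OF lie.grading])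
    have "c \<in> rep_kernel \<rho>" "d \<in> rep_kernel \<rho>" using parts[of c d] Y cd by auto
    then show "br X Y \<in> rep_kernel \<rho>" "br Y X \<in> rep_kernel \<rho>"
      using X cd hom sub by (simp_all add: lie.br_simps real_vector.subspace_add)
  qed
qed

end

lemma unitary_rep_comp:
  assumes rep: "unitary_rep L br cscale H ip \<rho>"
    and lin: "\<And>X Y. f (X + Y) = f X + f Y" "\<And>r X. f (r *\<^sub>R X) = r *\<^sub>R f X"
    and even: "\<And>p X. X \<in> L' p \<Longrightarrow> f X \<in> L p"
    and hom: "\<And>p q X Y. X \<in> L' p \<Longrightarrow> Y \<in> L' q \<Longrightarrow> f (br' X Y) = br (f X) (f Y)"
  shows "unitary_rep L' br' cscale H ip (\<lambda>X. \<rho> (f X))"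
  using rep even unfolding unitary_rep_def by (simp add: lin hom)

theorem theorem4p9:
  fixes L :: "bit \<Rightarrow> 'k::euclidean_space set"
    and br :: "'k \<Rightarrow> 'k \<Rightarrow> 'k"
    and cscale :: "complex \<Rightarrow> 'h::ab_group_add \<Rightarrow> 'h"
    and H :: "bit \<Rightarrow> 'h set"
    and ip :: "'h \<Rightarrow> 'h \<Rightarrow> complex"
  assumes "simple_lie_superalgebra L br"
    and "compact_lie_superalgebra L br"
    and "L 1 \<noteq> {0}"
    and "pre_hilbert_superspace cscale H ip"
  shows "(\<forall>\<rho>. unitary_rep (current_grading L) (current_bracket L br) cscale H ip \<rho> \<longrightarrow>
            (current_plus :: ('k ^ 's::{finite,linorder} set) set) \<subseteq> rep_kernel \<rho>) \<and>
         bij_betw (\<lambda>\<rho> x. \<rho> ((\<one>\<^sub>\<Lambda> :: real ^ 's set) \<otimes>\<^sub>\<Lambda> x))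
           {\<rho>. unitary_rep (current_grading L) (current_bracket L br) cscale H ip \<rho>}
           {\<sigma>. unitary_rep L br cscale H ip \<sigma>}"
proof -
  interpret pre_hilbert_superspace cscale H ip by fact
  have lie: "lie_superalgebra L br" using assms(1) by (simp add: simple_lie_superalgebra_def)
  interpret lie_superalgebra L br by fact
  let ?rep = "unitary_rep (current_grading L) (current_bracket L br) cscale H ip :: ('k ^ 's set \<Rightarrow> _) \<Rightarrow> bool"
  have kernel: "current_plus \<subseteq> rep_kernel \<rho>" if rep: "?rep \<rho>" for \<rho>
  proof (rule current_plus_subset_graded_ideal[OF assms(1)])
    show "graded_ideal (current_grading L) (current_bracket L br) (rep_kernel \<rho>)"
      by (rule graded_ideal_rep_kernel[OF lie_superalgebra_current[OF lie] rep])
  next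
    fix i :: 's and x assume x: "x \<in> L 0"
    show "eps i \<otimes>\<^sub>\<Lambda> x \<in> rep_kernel \<rho>"
    proof (rule odd_null_in_rep_kernel[OF rep])
      show "eps i \<otimes>\<^sub>\<Lambda> x \<in> current_grading L 1"
        using axis_tensor_in_current_grading[OF lie x, of "{i}" 1] by (simp add: eps_def)
      have "eps i \<bullet>\<^sub>\<Lambda> eps i = 0" by (simp add: eps_def gmult_axis)
      then show "current_bracket L br (eps i \<otimes>\<^sub>\<Lambda> x) (eps i \<otimes>\<^sub>\<Lambda> x) = 0"
        using current_bracket_tensor[OF lie x axis_in_grassmann_grading, of "eps i" "{i}" 1 x]
        by (simp add: eps_def tensor_def vec_eq_iff)
    qed
  qed
  have one: "(\<one>\<^sub>\<Lambda> \<otimes>\<^sub>\<Lambda> x) $ {} = x" for x :: 'k by (simp add: gone_def tensor_def)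
  have restrict: "unitary_rep L br cscale H ip (\<lambda>x. \<rho> (\<one>\<^sub>\<Lambda> \<otimes>\<^sub>\<Lambda> x))" if "?rep \<rho>" for \<rho>
    using that
  proof (rule unitary_rep_comp)
    show "\<one>\<^sub>\<Lambda> \<otimes>\<^sub>\<Lambda> x \<in> current_grading L p" if "x \<in> L p" for x p
      using axis_tensor_in_current_grading[OF lie that, of "{}" 1] by (simp add: gone_def del: add_bit_eq_xor)
  qed (simp_all add: tensor_linear current_bracket_tensor_one[OF lie])
  have extend: "?rep (\<lambda>X. \<sigma> (X $ {}))" if "unitary_rep L br cscale H ip \<sigma>" for \<sigma>
    using that
  proof (rule unitary_rep_comp)
    show "X $ {} \<in> L p" if "X \<in> current_grading L p" for X :: "'k ^ 's set" and p
      using that by (auto simp: current_grading_def simp del: add_bit_eq_xor dest: spec[of _ "{}"])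
    show "current_bracket L br X Y $ {} = br (X $ {}) (Y $ {})"
      if "X \<in> current_grading L p" for X Y :: "'k ^ 's set" and p
      using current_bracket_homogeneous[OF lie that, of Y "{}"] by (simp add: ksign_def)
  qed simp_all
  have determined: "\<rho> (\<one>\<^sub>\<Lambda> \<otimes>\<^sub>\<Lambda> X $ {}) = \<rho> X" if rep: "?rep \<rho>" for \<rho> and X :: "'k ^ 's set"
  proof
    fix v
    have "X - \<one>\<^sub>\<Lambda> \<otimes>\<^sub>\<Lambda> X $ {} \<in> rep_kernel \<rho>"
      using kernel[OF rep] by (auto simp: current_plus_iff one)
    moreover have "\<rho> ((X - \<one>\<^sub>\<Lambda> \<otimes>\<^sub>\<Lambda> X $ {}) + \<one>\<^sub>\<Lambda> \<otimes>\<^sub>\<Lambda> X $ {}) v =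
        \<rho> (X - \<one>\<^sub>\<Lambda> \<otimes>\<^sub>\<Lambda> X $ {}) v + \<rho> (\<one>\<^sub>\<Lambda> \<otimes>\<^sub>\<Lambda> X $ {}) v"
      using rep unfolding unitary_rep_def by blast
    ultimately show "\<rho> (\<one>\<^sub>\<Lambda> \<otimes>\<^sub>\<Lambda> X $ {}) v = \<rho> X v" by (simp add: rep_kernel_def)
  qed
  have "bij_betw (\<lambda>\<rho> x. \<rho> ((\<one>\<^sub>\<Lambda> :: real ^ 's set) \<otimes>\<^sub>\<Lambda> x)) {\<rho>. ?rep \<rho>} {\<sigma>. unitary_rep L br cscale H ip \<sigma>}"
    by (rule bij_betw_byWitness[where f' = "\<lambda>\<sigma> X. \<sigma> (X $ {})"])
       (auto simp: determined one restrict extend)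
  then show ?thesis using kernel by blast
qed

end
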